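(* Let $\{\,,\,\}_2$ be the Poisson bracket on $\mathcal{A}$ defined in the context, and let $P$ be the usual flip. Then $\{\,,\,\}_2$ can be represented as $$\{L_1(u),L_2(v)\}_2=\left[L_1(u)+L_1(v),\,\frac{P}{(u-v)^2}\right]-2\left[\int_v^u L_1(t)\,dt,\,\frac{P}{(u-v)^3}\right],$$ where, with $u=v+h$, both sides are understood as series in $h=u-v$ through the Taylor expansion of $L(v+h)$ described in the context.
   Context: Let $V=\mathbb{C}^n$ and let $P$ be the flip on $V\otimes V$. Let $L(v)=\|l_i^j(v)\|_{1\le i,j\le n}$ ($i$ labels the row, $j$ the column) be a matrix of functions of a parameter $v$, and let $L^{(k)}(v)=\frac{d^k}{dv^k}L(v)$, $L^{(0)}=L$. Let $\mathcal{A}$ be the commutative algebra of polynomials over $\mathbb{C}$ in the entries of $L^{(k)}(v)$, $k=0,1,2,\dots$, treated as independent generators. Write $L_1=L\otimes I$, $L_2=I\otimes L$ (similarly for other matrices). For two matrices $A,B$ of the same size with entries in $\mathcal{A}$, $\{A,B\}$ denotes the matrix with entries $\sum_k\{A_i^k,B_k^j\}$. $[\,,\,]$ is the matrix commutator. The bracket $\{\,,\,\}_2$ on $\mathcal{A}$ is defined on generators by $$\{L_1^{(k)}(v),L_2^{(l)}(v)\}_2=\alpha_2(k,l)\,[L_1^{(k+l+2)}(v),P],\qquad \alpha_2(k,l)=\frac{(k+1)!\,(l+1)!}{(k+l+3)!},\quad k,l\ge 0,$$ and extended to $\mathcal{A}$ by the Leibniz rule. In entries, the bracket of the $(i,j)$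 entry of $L^{(k)}$ with the $(p,q)$ entry of $L^{(l)}$ is $\alpha_2(k,l)\left(\delta_p^j\,(L^{(k+l+2)})_i^q-\delta_i^q\,(L^{(k+l+2)})_p^j\right)$. Meaning of the bracket at two different parameter values: put $u=v+h$ and use $L(v+h)=\sum_{k\ge0}\frac{h^k}{k!}L^{(k)}(v)$, so that $$\{L_1(v+h),L_2(v)\}_2=\sum_{k\ge 0}\frac{h^k}{k!}\{L_1^{(k)}(v),L_2(v)\}_2,\qquad \int_v^{v+h}L(t)\,dt=\sum_{k\ge0}\frac{h^{k+1}}{(k+1)!}L^{(k)}(v).$$ *)

theory Defs
  imports
    "HOL-Analysis.Finite_Cartesian_Product"
    "HOL-Library.Poly_Mapping"
    "HOL-Computational_Algebra.Formal_Laurent_Series"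
begin

unbundle no fps_syntax

text \<open>
  The index \<open>(k, i, j)\<close> stands for the entry in row \<open>i\<close> and column \<open>j\<close> of the \<open>k\<close>-th derivative
  of \<open>L\<close> at the fixed base point \<open>v\<close>. A monomial is a finitely supported exponent function on
  these indices, so the product of poly mappings is the product of polynomials.
\<close>

type_synonym 'n ix = "nat \<times> 'n \<times> 'n"
type_synonym 'n alg = "('n ix \<Rightarrow>\<^sub>0 nat) \<Rightarrow>\<^sub>0 complex"

definition cst :: "complex \<Rightarrow> 'n alg" where
  "cst c = Poly_Mapping.single 0 c"

definition gen :: "'n ix \<Rightarrow> 'n alg" where
  "gen x = Poly_Mapping.single (Poly_Mapping.single x 1) 1"

definition vars :: "'n alg \<Rightarrow> 'n ix set" where
  "vars f = (\<Union>m\<in>Poly_Mapping.keys f. Poly_Mapping.keys m)"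

definition partial :: "'n ix \<Rightarrow> 'n alg \<Rightarrow> 'n alg" where
  "partial x f = (\<Sum>m\<in>Poly_Mapping.keys f.
     Poly_Mapping.single (m - Poly_Mapping.single x 1)
       (of_nat (Poly_Mapping.lookup m x) * Poly_Mapping.lookup f m))"

definition alpha2 :: "nat \<Rightarrow> nat \<Rightarrow> complex" where
  "alpha2 k l = fact (k + 1) * fact (l + 1) / fact (k + l + 3)"

fun gen_bracket2 :: "'n ix \<Rightarrow> 'n ix \<Rightarrow> 'n alg" where
  "gen_bracket2 (k, i, j) (l, p, q) = cst (alpha2 k l) *
     ((if p = j then gen (k + l + 2, i, q) else 0) - (if i = q then gen (k + l + 2, p, j) else 0))"

text \<open>
  The extension by the Leibniz rule, written in coordinates. Lemmas \<open>bracket2_gen\<close>,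
  \<open>biderivation_bracket2\<close> and \<open>bracket2_unique\<close> below show that it is the only biderivation
  with the prescribed values on the generators; \<open>bracket2_skew\<close> and \<open>bracket2_jacobi\<close> show that
  it is a Poisson bracket.
\<close>

definition bracket2 :: "'n alg \<Rightarrow> 'n alg \<Rightarrow> 'n alg" where
  "bracket2 f g = (\<Sum>x\<in>vars f. \<Sum>y\<in>vars g. partial x f * partial y g * gen_bracket2 x y)"

definition derivation :: "('n alg \<Rightarrow> 'n alg) \<Rightarrow> bool" where
  "derivation D \<longleftrightarrow> (\<forall>f g. D (f + g) = D f + D g) \<and> (\<forall>c f. D (cst c * f) = cst c * D f) \<and>
     (\<forall>f g. D (f * g) = D f * g + f * D g)"

definition biderivation :: "('n alg \<Rightarrow> 'n alg \<Rightarrow> 'n alg) \<Rightarrow> bool" where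
  "biderivation br \<longleftrightarrow> (\<forall>g. derivation (\<lambda>f. br f g)) \<and> (\<forall>f. derivation (br f))"

text \<open>
  On power series in \<open>h = u - v\<close> the bracket is taken coefficientwise, \<open>h\<close> being a scalar.
  Lemma \<open>mat_bracket_series\<close> below computes it on the Taylor series of \<open>L\<close>.
\<close>

definition bracket2_fps :: "'n alg fps \<Rightarrow> 'n alg fps \<Rightarrow> 'n alg fps" where
  "bracket2_fps F G = Abs_fps (\<lambda>m. \<Sum>k\<le>m. bracket2 (fps_nth F k) (fps_nth G (m - k)))"

text \<open>
  Matrices on \<open>V \<otimes> V\<close> are indexed by pairs: the first components belong to the first
  tensor factor and the second components to the second one.
\<close>

definition tens1 :: "'a::semiring_1 ^'n::finite^'n \<Rightarrow> 'a ^('n \<times> 'n)^('n \<times> 'n)" where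
  "tens1 A = (\<chi> a b. if snd a = snd b then A $ fst a $ fst b else 0)"

definition tens2 :: "'a::semiring_1 ^'n::finite^'n \<Rightarrow> 'a ^('n \<times> 'n)^('n \<times> 'n)" where
  "tens2 A = (\<chi> a b. if fst a = fst b then A $ snd a $ snd b else 0)"

definition flip_mat :: "'a::semiring_1 ^('n::finite \<times> 'n)^('n \<times> 'n)" where
  "flip_mat = (\<chi> a b. if a = prod.swap b then 1 else 0)"

definition commutator :: "'a::ring_1 ^'m::finite^'m \<Rightarrow> 'a ^'m::finite^'m \<Rightarrow> 'a ^'m::finite^'m" where
  "commutator A B = A ** B - B ** A"

definition scale_mat :: "'a::semiring_1 \<Rightarrow> 'a ^'m::finite^'m \<Rightarrow> 'a ^'m::finite^'m" where
  "scale_mat c A = (\<chi> a b. c * A $ a $ b)"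

definition mat_bracket :: "('a \<Rightarrow> 'a \<Rightarrow> 'a::comm_monoid_add) \<Rightarrow> 'a ^'m::finite^'m \<Rightarrow> 'a ^'m::finite^'m \<Rightarrow> 'a ^'m::finite^'m"
  where "mat_bracket br A B = (\<chi> a b. \<Sum>c\<in>UNIV. br (A $ a $ c) (B $ c $ b))"

text \<open>
  Division by powers of \<open>h = u - v\<close> takes place in Laurent series, where \<open>fls_X\<close> is \<open>h\<close> and
  \<open>fls_X_inv\<close> is its inverse.
\<close>

definition laurent_mat :: "'a::zero fps ^'m::finite^'m \<Rightarrow> 'a fls ^'m::finite^'m" where
  "laurent_mat A = (\<chi> a b. fps_to_fls (A $ a $ b))"

definition Lmat :: "nat \<Rightarrow> 'n alg ^'n::finite^'n" where
  "Lmat k = (\<chi> i j. gen (k, i, j))"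

text \<open>\<open>L(v)\<close>, \<open>L(v + h)\<close> and the integral of \<open>L\<close> from \<open>v\<close> to \<open>v + h\<close>, as power series in \<open>h\<close>.\<close>

definition L_v :: "'n alg fps ^'n::finite^'n" where
  "L_v = (\<chi> i j. fps_const (Lmat 0 $ i $ j))"

definition L_u :: "'n alg fps ^'n::finite^'n" where
  "L_u = (\<chi> i j. Abs_fps (\<lambda>k. cst (1 / fact k) * Lmat k $ i $ j))"

definition L_int :: "'n alg fps ^'n::finite^'n" where
  "L_int = (\<chi> i j. fps_X * Abs_fps (\<lambda>k. cst (1 / fact (k + 1)) * Lmat k $ i $ j))"

lemma cst_0 [simp]: "cst 0 = 0" and cst_1 [simp]: "cst 1 = 1"
  by (simp_all add: cst_def)

lemma cst_mult: "cst (a * b) = cst a * cst b"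
  by (simp add: cst_def mult_single)

lemma sum_singles:
  "(\<Sum>n\<in>Poly_Mapping.keys f. Poly_Mapping.single n (Poly_Mapping.lookup f n)) = f"
  by (rule poly_mapping_eqI)
     (auto simp: lookup_sum lookup_single when_def in_keys_iff sum.delta)

lemma alg_induct [case_names cst gen add mult]:
  fixes f :: "'n alg"
  assumes c: "\<And>c. Q (cst c)" and g: "\<And>x. Q (gen x)"
    and a: "\<And>f g. Q f \<Longrightarrow> Q g \<Longrightarrow> Q (f + g)" and m: "\<And>f g. Q f \<Longrightarrow> Q g \<Longrightarrow> Q (f * g)"
  shows "Q f"
proof -
  have pw: "Q (Poly_Mapping.single (Poly_Mapping.single x k) 1)" for x k
  proof (induction k)
    case 0
    then show ?case using c[of 1] by (simp add: cst_def)
  next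
    case (Suc k)
    have "Poly_Mapping.single (Poly_Mapping.single x (Suc k)) 1 =
        gen x * Poly_Mapping.single (Poly_Mapping.single x k) 1"
      by (simp add: gen_def mult_single flip: single_add)
    then show ?case using m[OF g Suc] by simp
  qed
  have su: "Q (\<Sum>x\<in>S. t x)" if "\<And>x. x \<in> S \<Longrightarrow> Q (t x)" for S and t :: "'b \<Rightarrow> 'n alg"
    using that by (induction S rule: infinite_finite_induct) (use c[of 0] a in auto)
  have mon: "Q (Poly_Mapping.single (\<Sum>x\<in>S. Poly_Mapping.single x (t x)) 1)" for S and t :: "'n ix \<Rightarrow> nat"
  proof (induction S rule: infinite_finite_induct)
    case (insert x S)
    then show ?case
      using m[OF pw[of x "t x"] insert.IH] by (simp add: mult_single)
  qed (use c[of 1] in \<open>simp_all add: cst_def\<close>)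
  have mon': "Q (Poly_Mapping.single n 1)" for n
    using mon[of "Poly_Mapping.lookup n" "Poly_Mapping.keys n"] by (simp add: sum_singles)
  have "Q (Poly_Mapping.single n b)" for n b
    using m[OF c[of b] mon'[of n]] by (simp add: cst_def mult_single)
  then have "Q (\<Sum>n\<in>Poly_Mapping.keys f. Poly_Mapping.single n (Poly_Mapping.lookup f n))"
    by (intro su)
  then show ?thesis by (simp add: sum_singles)
qed

lemma derivation_sum:
  fixes D :: "'i \<Rightarrow> 'n alg \<Rightarrow> 'n alg"
  assumes "\<And>i. i \<in> S \<Longrightarrow> derivation (D i)"
  shows "derivation (\<lambda>f. \<Sum>i\<in>S. D i f)"
  unfolding derivation_def
proof (intro conjI allI)
  fix f g :: "'n alg" and c
  show "(\<Sum>i\<in>S. D i (f + g)) = (\<Sum>i\<in>S. D i f) + (\<Sum>i\<in>S. D i g)"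
    using assms by (simp add: derivation_def sum.distrib)
  show "(\<Sum>i\<in>S. D i (f * g)) = (\<Sum>i\<in>S. D i f) * g + f * (\<Sum>i\<in>S. D i g)"
    using assms by (simp add: derivation_def sum.distrib sum_distrib_left sum_distrib_right)
  have "(\<Sum>i\<in>S. D i (cst c * f)) = (\<Sum>i\<in>S. cst c * D i f)"
    using assms unfolding derivation_def by (intro sum.cong refl) blast
  then show "(\<Sum>i\<in>S. D i (cst c * f)) = cst c * (\<Sum>i\<in>S. D i f)"
    by (simp add: sum_distrib_left)
qed

lemma derivation_mult: "derivation D \<Longrightarrow> derivation (\<lambda>f. D f * a)"
  unfolding derivation_def by (auto simp: algebra_simps)

lemma derivation_cst:
  assumes "derivation D"
  shows "D (cst c) = 0"
proof -
  have "D (1 * 1) = D 1 * 1 + 1 * D 1" using assms unfolding derivation_def by blast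
  then have "D 1 = 0" by simp
  moreover have "D (cst c * 1) = cst c * D 1" using assms unfolding derivation_def by blast
  ultimately show ?thesis by simp
qed

lemma derivation_unique:
  assumes "derivation D" "derivation E" "\<And>x. D (gen x) = E (gen x)"
  shows "D f = E f"
proof (induction f rule: alg_induct)
  case (cst c)
  show ?case using assms(1,2) by (simp add: derivation_cst)
qed (use assms in \<open>simp_all add: derivation_def\<close>)

lemma partial_superset:
  assumes "finite S" "Poly_Mapping.keys f \<subseteq> S"
  shows "partial x f = (\<Sum>m\<in>S. Poly_Mapping.single (m - Poly_Mapping.single x 1)
       (of_nat (Poly_Mapping.lookup m x) * Poly_Mapping.lookup f m))"
  unfolding partial_def
  by (rule sum.mono_neutral_left) (use assms in \<open>auto simp: in_keys_iff\<close>)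

lemma partial_add: "partial x (f + g) = partial x f + partial x g"
proof -
  let ?S = "Poly_Mapping.keys f \<union> Poly_Mapping.keys g"
  have fin: "finite ?S" by simp
  have sub: "Poly_Mapping.keys f \<subseteq> ?S" "Poly_Mapping.keys g \<subseteq> ?S"
    "Poly_Mapping.keys (f + g) \<subseteq> ?S"
    using Poly_Mapping.keys_add[of f g] by auto
  show ?thesis
    unfolding partial_superset[OF fin sub(1)] partial_superset[OF fin sub(2)]
      partial_superset[OF fin sub(3)] sum.distrib[symmetric] lookup_add distrib_left single_add
    by (rule refl)
qed

lemma partial_0 [simp]: "partial x 0 = 0"
  by (simp add: partial_def)

lemma partial_sum: "partial x (\<Sum>i\<in>S. f i) = (\<Sum>i\<in>S. partial x (f i))"
  by (induction S rule: infinite_finite_induct) (simp_all add: partial_add)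

lemma partial_single: "partial x (Poly_Mapping.single m c) =
    Poly_Mapping.single (m - Poly_Mapping.single x 1) (of_nat (Poly_Mapping.lookup m x) * c)"
  by (subst partial_superset[of "{m}"]) (auto simp: lookup_single)

lemma partial_mult_single:
  fixes m n :: "'n ix \<Rightarrow>\<^sub>0 nat"
  shows "partial x (Poly_Mapping.single m c * Poly_Mapping.single n d) =
    partial x (Poly_Mapping.single m c) * Poly_Mapping.single n d +
    Poly_Mapping.single m c * partial x (Poly_Mapping.single n d)"
proof -
  let ?e = "Poly_Mapping.single x (1::nat)"
  have 1: "m - ?e + n = m + n - ?e" if "Poly_Mapping.lookup m x \<noteq> 0" for m n :: "'n ix \<Rightarrow>\<^sub>0 nat"
    using that by (intro poly_mapping_eqI) (auto simp: lookup_add lookup_minus lookup_single when_def)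
  have "Poly_Mapping.single (m - ?e + n) (of_nat (Poly_Mapping.lookup m x) * c * d) =
      Poly_Mapping.single (m + n - ?e) (of_nat (Poly_Mapping.lookup m x) * c * d)"
    by (cases "Poly_Mapping.lookup m x = 0") (simp_all add: 1 del: One_nat_def)
  moreover have "Poly_Mapping.single (m + (n - ?e)) (c * (of_nat (Poly_Mapping.lookup n x) * d)) =
      Poly_Mapping.single (m + n - ?e) (c * (of_nat (Poly_Mapping.lookup n x) * d))"
    using 1[of n m] by (cases "Poly_Mapping.lookup n x = 0") (simp_all add: add.commute del: One_nat_def)
  moreover have "of_nat (Poly_Mapping.lookup (m + n) x) * (c * d) =
      of_nat (Poly_Mapping.lookup m x) * c * d + c * (of_nat (Poly_Mapping.lookup n x) * d)"
    by (simp add: lookup_add algebra_simps)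
  ultimately show ?thesis
    by (simp only: partial_single mult_single single_add)
qed

lemma partial_mult: "partial x (f * g) = partial x f * g + f * partial x g"
proof -
  define s where "s h = (\<Sum>n\<in>Poly_Mapping.keys h. Poly_Mapping.single n (Poly_Mapping.lookup h n))"
    for h :: "'a alg"
  have "partial x (s f * s g) = partial x (s f) * s g + s f * partial x (s g)"
    unfolding s_def sum_product partial_sum partial_mult_single sum.distrib by simp
  then show ?thesis by (simp add: s_def sum_singles)
qed

lemma partial_cst [simp]: "partial x (cst c) = 0"
  by (simp add: cst_def partial_single)

lemma derivation_partial: "derivation (partial x)"
  by (simp add: derivation_def partial_add partial_mult)

lemma partial_gen: "partial x (gen y) = (if x = y then 1 else 0)"
  by (simp add: gen_def partial_single lookup_single when_def)

lemma finite_vars [simp]: "finite (vars f)"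
  by (simp add: vars_def)

lemma partial_not_in_vars: "x \<notin> vars f \<Longrightarrow> partial x f = 0"
  unfolding partial_def vars_def by (intro sum.neutral) (auto simp: in_keys_iff)

lemma bracket2_superset:
  assumes "finite S" "vars f \<subseteq> S" "finite T" "vars g \<subseteq> T"
  shows "bracket2 f g = (\<Sum>x\<in>S. \<Sum>y\<in>T. partial x f * partial y g * gen_bracket2 x y)"
proof -
  have "bracket2 f g = (\<Sum>x\<in>vars f. \<Sum>y\<in>T. partial x f * partial y g * gen_bracket2 x y)"
    unfolding bracket2_def
    by (intro sum.cong refl sum.mono_neutral_left) (use assms in \<open>auto simp: partial_not_in_vars\<close>)
  also have "\<dots> = (\<Sum>x\<in>S. \<Sum>y\<in>T. partial x f * partial y g * gen_bracket2 x y)"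
    by (intro sum.mono_neutral_left) (use assms in \<open>auto simp: partial_not_in_vars\<close>)
  finally show ?thesis .
qed

lemma vars_gen: "vars (gen x) = {x}"
  by (simp add: vars_def gen_def)

lemma bracket2_gen: "bracket2 (gen x) (gen y) = gen_bracket2 x y"
  by (simp add: bracket2_def vars_gen partial_gen)

lemma alpha2_commute: "alpha2 k l = alpha2 l k"
  by (simp add: alpha2_def add.commute mult.commute)

lemma gen_bracket2_skew: "gen_bracket2 y x = - gen_bracket2 x y"
proof -
  obtain k i j where x: "x = (k, i, j)" by (cases x)
  obtain l p q where y: "y = (l, p, q)" by (cases y)
  show ?thesis
    by (simp add: x y alpha2_commute[of l k] add.commute[of l k] flip: mult_minus_right)
qed

lemma bracket2_skew: "bracket2 g f = - bracket2 f g"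
proof -
  have "bracket2 g f = (\<Sum>y\<in>vars f. \<Sum>x\<in>vars g. partial x g * partial y f * gen_bracket2 x y)"
    unfolding bracket2_def by (rule sum.swap)
  also have "\<dots> = - bracket2 f g"
    unfolding bracket2_def sum_negf[symmetric]
  proof (intro sum.cong refl)
    fix x y :: "'a ix"
    show "partial x g * partial y f * gen_bracket2 x y = - (partial y f * partial x g * gen_bracket2 y x)"
      by (subst gen_bracket2_skew) (simp add: mult.commute)
  qed
  finally show ?thesis .
qed

lemma derivation_bracket2_left: "derivation (\<lambda>f. bracket2 f g)"
proof -
  have D: "derivation (\<lambda>f. \<Sum>x\<in>S. \<Sum>y\<in>vars g. partial x f * partial y g * gen_bracket2 x y)" for S
    by (intro derivation_sum derivation_mult derivation_partial)
  have eq: "bracket2 f g = (\<Sum>x\<in>S. \<Sum>y\<in>vars g. partial x f * partial y g * gen_bracket2 x y)"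
    if "finite S" "vars f \<subseteq> S" for f S
    using that by (intro bracket2_superset) auto
  show ?thesis
    unfolding derivation_def
  proof (intro conjI allI)
    fix f f' :: "'a alg"
    let ?S = "vars f \<union> vars f' \<union> vars (f + f') \<union> vars (f * f')"
    have fin: "finite ?S" by simp
    show "bracket2 (f + f') g = bracket2 f g + bracket2 f' g"
      using D[of ?S] by (simp add: eq[OF fin] le_supI1 le_supI2 derivation_def)
    show "bracket2 (f * f') g = bracket2 f g * f' + f * bracket2 f' g"
      using D[of ?S] by (simp add: eq[OF fin] le_supI1 le_supI2 derivation_def)
  next
    fix c and f :: "'a alg"
    let ?S = "vars f \<union> vars (cst c * f)"
    have fin: "finite ?S" by simp
    show "bracket2 (cst c * f) g = cst c * bracket2 f g"
      using D[of ?S] by (simp add: eq[OF fin] le_supI1 le_supI2 derivation_def)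
  qed
qed

lemma biderivation_bracket2: "biderivation bracket2"
proof -
  have "derivation (bracket2 f)" for f :: "'a alg"
  proof -
    have "bracket2 f = (\<lambda>g. bracket2 g f * - 1)"
      by (rule ext, subst bracket2_skew) simp
    then show ?thesis by (simp only: derivation_mult[OF derivation_bracket2_left])
  qed
  then show ?thesis by (simp add: biderivation_def derivation_bracket2_left)
qed

lemma bracket2_unique:
  assumes "biderivation br" "\<And>x y. br (gen x) (gen y) = gen_bracket2 x y"
  shows "br = bracket2"
proof (intro ext)
  fix f g
  have "br f (gen y) = bracket2 f (gen y)" for y
    by (rule derivation_unique[where D = "\<lambda>f. br f (gen y)" and E = "\<lambda>f. bracket2 f (gen y)"])
       (use assms biderivation_bracket2 in \<open>auto simp: biderivation_def bracket2_gen\<close>)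
  then show "br f g = bracket2 f g"
    by (rule derivation_unique[where D = "br f", rotated 2])
       (use assms biderivation_bracket2 in \<open>auto simp: biderivation_def\<close>)
qed

lemma bracket2_linear:
  "bracket2 (f + f') g = bracket2 f g + bracket2 f' g"
  "bracket2 f (g + g') = bracket2 f g + bracket2 f g'"
  "bracket2 (f - f') g = bracket2 f g - bracket2 f' g"
  "bracket2 f (g - g') = bracket2 f g - bracket2 f g'"
  "bracket2 (cst c) g = 0" "bracket2 f (cst c) = 0"
  "bracket2 0 g = 0" "bracket2 f 0 = 0"
  "bracket2 (cst c * f) g = cst c * bracket2 f g"
  "bracket2 f (cst c * g) = cst c * bracket2 f g"
  "bracket2 (f * f') g = bracket2 f g * f' + f * bracket2 f' g"
  "bracket2 f (g * g') = bracket2 f g * g' + g * bracket2 f g'"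
proof -
  have B: "derivation (\<lambda>f. bracket2 f g)" "derivation (bracket2 f)" for f g :: "'a alg"
    using biderivation_bracket2 by (auto simp: biderivation_def)
  show l: "bracket2 (f + f') g = bracket2 f g + bracket2 f' g" for f f' g :: "'a alg"
    using B(1)[of g] by (simp add: derivation_def)
  show r: "bracket2 f (g + g') = bracket2 f g + bracket2 f g'" for f g g' :: "'a alg"
    using B(2)[of f] by (simp add: derivation_def)
  show "bracket2 (f - f') g = bracket2 f g - bracket2 f' g"
    using l[of "f - f'" f' g] by simp
  show "bracket2 f (g - g') = bracket2 f g - bracket2 f g'"
    using r[of f "g - g'" g'] by simp
  show c: "bracket2 (cst c) g = 0" "bracket2 f (cst c) = 0" for c
    using derivation_cst[OF B(1)[of g]] derivation_cst[OF B(2)[of f]] by simp_all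
  show "bracket2 0 g = 0" "bracket2 f 0 = 0"
    using c[of 0] by simp_all
  show "bracket2 (cst c * f) g = cst c * bracket2 f g"
    "bracket2 (f * f') g = bracket2 f g * f' + f * bracket2 f' g" for c
    using B(1)[of g] unfolding derivation_def by blast+
  show "bracket2 f (cst c * g) = cst c * bracket2 f g"
    "bracket2 f (g * g') = bracket2 f g * g' + g * bracket2 f g'" for c
    using B(2)[of f] unfolding derivation_def by blast+
qed

definition jacobiator :: "'n alg \<Rightarrow> 'n alg \<Rightarrow> 'n alg \<Rightarrow> 'n alg" where
  "jacobiator f g h = bracket2 f (bracket2 g h) + bracket2 g (bracket2 h f) + bracket2 h (bracket2 f g)"

lemma jacobiator_cyclic: "jacobiator f g h = jacobiator g h f"
  by (simp add: jacobiator_def algebra_simps)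

lemma derivation_jacobiator: "derivation (\<lambda>f. jacobiator f g h)"
  unfolding derivation_def
proof (intro conjI allI)
  fix a b :: "'a alg"
  show "jacobiator (a * b) g h = jacobiator a g h * b + a * jacobiator b g h"
    unfolding jacobiator_def bracket2_linear
    by (simp add: bracket2_skew[of a g] bracket2_skew[of b g] bracket2_skew[of a h] bracket2_skew[of b h]
        algebra_simps)
qed (simp_all add: jacobiator_def bracket2_linear algebra_simps)

lemma alpha2_assoc: "alpha2 k l * alpha2 (k + l + 2) m =
    fact (k + 1) * fact (l + 1) * fact (m + 1) / fact (k + l + m + 5)"
proof -
  have e: "(k + l + 2) + 1 = k + l + 3" "(k + l + 2) + m + 3 = k + l + m + 5" by simp_all
  have "a / b * (b * c / d) = a * c / d" if "b \<noteq> 0" for a b c d :: complex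
    using that by simp
  from this[OF fact_nonzero] show ?thesis unfolding alpha2_def e .
qed

lemma jacobiator_gen: "jacobiator (gen x) (gen y) (gen z) = 0"
proof -
  obtain k i j where x: "x = (k, i, j)" by (cases x)
  obtain l p q where y: "y = (l, p, q)" by (cases y)
  obtain m r s where z: "z = (m, r, s)" by (cases z)
  define c where "c = alpha2 k l * alpha2 (k + l + 2) m"
  have c: "alpha2 l m * alpha2 k (l + m + 2) = c" "alpha2 m k * alpha2 l (m + k + 2) = c"
    "alpha2 k l * alpha2 m (k + l + 2) = c"
    unfolding c_def alpha2_commute[of k "l + m + 2"] alpha2_commute[of l "m + k + 2"]
      alpha2_commute[of m "k + l + 2"] alpha2_assoc
    by (simp_all only: ac_simps)
  define N where "N = k + l + m + 4"
  have N: "k + (l + m + 2) + 2 = N" "l + (m + k + 2) + 2 = N" "m + (k + l + 2) + 2 = N"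
    by (simp_all add: N_def)
  have B: "bracket2 (gen (k, i, j)) (bracket2 (gen (l, p, q)) (gen (m, r, s))) =
      cst (alpha2 l m * alpha2 k (l + m + 2)) *
      ((if r = q then (if p = j then gen (k + (l + m + 2) + 2, i, s) else 0)
                     - (if i = s then gen (k + (l + m + 2) + 2, p, j) else 0) else 0)
      - (if p = s then (if r = j then gen (k + (l + m + 2) + 2, i, q) else 0)
                     - (if i = q then gen (k + (l + m + 2) + 2, r, j) else 0) else 0))"
    for k l m and i j p q r s :: 'a
    unfolding bracket2_gen gen_bracket2.simps bracket2_linear cst_mult mult.assoc mult_zero_left add_0_left
    by (rule arg_cong[of _ _ "\<lambda>t. cst (alpha2 l m) * t"])
       (simp add: bracket2_gen bracket2_linear right_diff_distrib)
  show ?thesis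
    unfolding jacobiator_def x y z B c N distrib_left[symmetric] by auto
qed

lemma bracket2_jacobi:
  "bracket2 f (bracket2 g h) + bracket2 g (bracket2 h f) + bracket2 h (bracket2 f g) = 0"
proof -
  have z: "derivation (\<lambda>_ :: 'a alg. 0)" by (simp add: derivation_def)
  have 1: "jacobiator f (gen y) (gen w) = 0" for f :: "'a alg" and y w
    by (rule derivation_unique[OF derivation_jacobiator z jacobiator_gen])
  have 2: "jacobiator f g (gen w) = 0" for f g :: "'a alg" and w
  proof -
    have "jacobiator g (gen w) f = 0"
      by (rule derivation_unique[OF derivation_jacobiator z]) (metis 1 jacobiator_cyclic)
    then show ?thesis by (metis jacobiator_cyclic)
  qed
  have "jacobiator f g h = 0"
    by (rule derivation_unique[OF derivation_jacobiator z]) (metis 2 jacobiator_cyclic)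
  then show ?thesis by (simp add: jacobiator_def)
qed

lemma mat_bracket_tens: "mat_bracket bracket2 (tens1 A) (tens2 B) $ (i, p) $ (j, q) =
    bracket2 (A $ i $ j) (B $ p $ q)"
proof -
  have "mat_bracket bracket2 (tens1 A) (tens2 B) $ (i, p) $ (j, q) =
      (\<Sum>c\<in>UNIV. if c = (j, p) then bracket2 (A $ i $ j) (B $ p $ q) else 0)"
    unfolding mat_bracket_def tens1_def tens2_def
    by (simp add: bracket2_linear if_distrib prod_eq_iff)
       (intro sum.cong refl, auto simp: bracket2_linear)
  then show ?thesis by simp
qed

lemma commutator_flip: "commutator (tens1 A) flip_mat $ (i, p) $ (j, q) =
    (if p = j then A $ i $ q else 0) - (if i = q then A $ p $ j else 0)"
proof -
  have "(tens1 A ** flip_mat) $ (i, p) $ (j, q) =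
      (\<Sum>c\<in>UNIV. if c = (q, j) then (if p = j then A $ i $ q else 0) else 0)"
    unfolding matrix_matrix_mult_def tens1_def flip_mat_def vec_lambda_beta
    by (intro sum.cong refl) auto
  moreover have "(flip_mat ** tens1 A) $ (i, p) $ (j, q) =
      (\<Sum>c\<in>UNIV. if c = (p, i) then (if i = q then A $ p $ j else 0) else 0)"
    unfolding matrix_matrix_mult_def tens1_def flip_mat_def vec_lambda_beta
    by (intro sum.cong refl) auto
  ultimately show ?thesis by (simp add: commutator_def)
qed

lemma mat_bracket_generators:
  "mat_bracket bracket2 (tens1 (Lmat k)) (tens2 (Lmat l)) =
    scale_mat (cst (alpha2 k l)) (commutator (tens1 (Lmat (k + l + 2))) flip_mat)"
  by (simp add: vec_eq_iff split_paired_all mat_bracket_tens commutator_flip scale_mat_def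
      Lmat_def bracket2_gen)

text \<open>The bracket at two parameter values is the series
  \<open>\<Sum>k. h^k / k! * {L\<^sub>1\<^sup>(\<^sup>k\<^sup>)(v), L\<^sub>2(v)}\<close>.\<close>

lemma mat_bracket_series:
  "fps_nth (mat_bracket bracket2_fps (tens1 L_u) (tens2 L_v) $ a $ b) k =
    cst (1 / fact k) * mat_bracket bracket2 (tens1 (Lmat k)) (tens2 (Lmat 0)) $ a $ b"
proof -
  have "fps_nth (bracket2_fps (tens1 L_u $ a $ c) (tens2 L_v $ c $ b)) k =
      cst (1 / fact k) * bracket2 (tens1 (Lmat k) $ a $ c) (tens2 (Lmat 0) $ c $ b)" for c
  proof -
    have "fps_nth (tens2 L_v $ c $ b) m = (if m = 0 then tens2 (Lmat 0) $ c $ b else 0)" for m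
      by (simp add: tens2_def L_v_def)
    then have "fps_nth (bracket2_fps (tens1 L_u $ a $ c) (tens2 L_v $ c $ b)) k =
        (\<Sum>m\<le>k. if m = k then bracket2 (fps_nth (tens1 L_u $ a $ c) k) (tens2 (Lmat 0) $ c $ b) else 0)"
      unfolding bracket2_fps_def fps_nth_Abs_fps
      by (intro sum.cong refl) (auto simp: bracket2_linear)
    then show ?thesis by (simp add: tens1_def L_u_def bracket2_linear)
  qed
  then show ?thesis by (simp add: mat_bracket_def fps_sum_nth sum_distrib_left)
qed

end

theory Submission
  imports Defs
begin

text \<open>
  Both sides are commutators with the flip \<open>P\<close>, so the claim reduces to an identity between
  series in \<open>h\<close>, one for each entry \<open>(i, j)\<close> of \<open>L\<close>. On the left, \<open>h^k\<close> carries
  \<open>\<alpha>\<^sub>2(k, 0) / k! = (k + 1) / (k + 3)!\<close> times \<open>L\<^sup>(\<^sup>k\<^sup>+\<^sup>2\<^sup>)\<close>. On the right, the Taylor series divided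
  by \<open>h\<^sup>2\<close> and the integral divided by \<open>h\<^sup>3\<close> contribute
  \<open>1 / (k + 2)! - 2 / (k + 3)!\<close>, which is the same number. The right side has at first sight
  a pole at \<open>h = 0\<close>, but it cancels: the coefficient of \<open>h\<^sup>-\<^sup>2\<close> is \<open>L + L - 2 L\<close> (this is where
  \<open>L(v)\<close> enters) and that of \<open>h\<^sup>-\<^sup>1\<close> is \<open>L' - 2 L' / 2!\<close>.
  Multiplying by \<open>h\<^sup>3\<close> turns all this into one identity of power series,
  lemma \<open>taylor_integral_identity\<close>; in Laurent series \<open>h\<close> is invertible, so the factor can be removed.
\<close>

unbundle no Formal_Power_Series.fps_syntax

lemma commutator_scale_right:
  fixes A B :: "'a::comm_ring_1 ^'m::finite^'m"
  shows "commutator A (scale_mat c B) = scale_mat c (commutator A B)"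
  by (simp add: vec_eq_iff commutator_def scale_mat_def matrix_matrix_mult_def
      sum_distrib_left right_diff_distrib mult.left_commute mult.assoc)

lemma tens1_add: "tens1 A + tens1 B = tens1 (A + B)"
  by (simp add: vec_eq_iff tens1_def)

lemma cst_add: "cst (a + b) = cst a + cst b"
  by (simp add: cst_def single_add)

text \<open>The entries of the matrix \<open>K\<close> with \<open>{L\<^sub>1(v + h), L\<^sub>2(v)}\<^sub>2 = [K\<^sub>1, P]\<close>.\<close>

definition bracket_kernel :: "'n \<Rightarrow> 'n \<Rightarrow> 'n alg fps" where
  "bracket_kernel i j =
    Abs_fps (\<lambda>k. cst (1 / fact k) * (cst (alpha2 k 0) * gen (k + 2, i, j)))"

text \<open>
  The coefficient of \<open>h^k\<close> on the left is a multiple of \<open>[L\<^sub>1\<^sup>(\<^sup>k\<^sup>+\<^sup>2\<^sup>), P]\<close>. Since \<open>P\<close> does not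
  depend on \<open>h\<close>, the sum over \<open>k\<close> can be taken inside the commutator.
\<close>

lemma mat_bracket_L_u_L_v:
  "mat_bracket bracket2_fps (tens1 L_u) (tens2 (L_v :: 'n::finite alg fps ^'n^'n)) =
    commutator (tens1 (\<chi> i j. bracket_kernel i j)) flip_mat"
proof -
  have "mat_bracket bracket2_fps (tens1 L_u) (tens2 L_v) $ (i, p) $ (j, q) =
      commutator (tens1 (\<chi> i j. bracket_kernel i j)) flip_mat $ (i, p) $ (j, q)" for i p j q :: 'n
    by (rule fps_ext, unfold mat_bracket_series mat_bracket_generators commutator_flip scale_mat_def)
       (simp add: bracket_kernel_def commutator_flip Lmat_def algebra_simps)
  then show ?thesis
    by (simp add: vec_eq_iff split_paired_all)
qed

lemma inverse_fact_alpha2: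
  "1 / fact (k + 2) - 2 / fact (k + 3) = 1 / fact k * alpha2 k 0"
proof -
  \<comment> \<open>every factorial becomes \<open>k!\<close> times linear factors in \<open>k\<close>, so both sides are rational in \<open>k\<close>\<close>
  define F :: complex where "F = fact k"
  have F: "F \<noteq> 0" by (simp add: F_def)
  have f: "fact (k + 1) = (of_nat k + 1) * F"
    "fact (k + 2) = (of_nat k + 2) * ((of_nat k + 1) * F)"
    "fact (k + 3) = (of_nat k + 3) * ((of_nat k + 2) * ((of_nat k + 1) * F))"
    by (simp_all add: F_def numeral_eq_Suc algebra_simps)
  have nz: "(of_nat k + 1 :: complex) \<noteq> 0" "(of_nat k + 2 :: complex) \<noteq> 0"
    "(of_nat k + 3 :: complex) \<noteq> 0"
    using of_nat_neq_0[of k, where 'a = complex] of_nat_neq_0[of "k + 1", where 'a = complex]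
      of_nat_neq_0[of "k + 2", where 'a = complex]
    by (simp_all add: add_ac)
  have \<alpha>: "alpha2 k 0 = (of_nat k + 1) * F / fact (k + 3)"
    unfolding alpha2_def f(1) by (simp del: fact_Suc)
  show ?thesis
    unfolding \<alpha> F_def[symmetric] f using F nz by (simp add: divide_simps)
qed

text \<open>
  The claim for one entry, multiplied by \<open>h\<^sup>3\<close> to stay within power series. The vanishing of the coefficients of \<open>h^1\<close> and \<open>h^2\<close> on the left
  is the cancellation of the pole.
\<close>

lemma taylor_integral_identity:
  fixes i j :: "'n::finite"
  shows "fps_X * (L_u $ i $ j + L_v $ i $ j) - 2 * L_int $ i $ j = fps_X ^ 3 * bracket_kernel i j"
proof (rule fps_ext)
  fix n :: nat
  have half: "2 * (cst (1 / 2) * g) = g" for g :: "'n alg"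
    unfolding mult_2 distrib_right[symmetric] cst_add[symmetric] by simp
  have two: "fps_nth (2 * f) m = 2 * fps_nth f m" for f :: "'n alg fps" and m
    unfolding mult_2 by (rule fps_add_nth)
  consider "n = 0" | "n = 1" | "n = 2" | k where "n = k + 3"
    using le_Suc_ex[of 3 n] by (cases "3 \<le> n") (force simp: add.commute)+
  then show "fps_nth (fps_X * (L_u $ i $ j + L_v $ i $ j) - 2 * L_int $ i $ j) n =
      fps_nth (fps_X ^ 3 * bracket_kernel i j) n"
  proof cases
    case 4
    have "cst (1 / fact (k + 2)) * g - 2 * (cst (1 / fact (k + 3)) * g) =
        cst (1 / fact k) * (cst (alpha2 k 0) * g)" for g :: "'n alg"
    proof -
      have "1 / fact (k + 2) = 1 / fact k * alpha2 k 0 + (1 / fact (k + 3) + 1 / fact (k + 3))"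
        using inverse_fact_alpha2[of k] by (simp add: algebra_simps del: fact_Suc)
      then have "(cst (1 / fact (k + 2)) :: 'n alg) =
          cst (1 / fact k) * cst (alpha2 k 0) + (cst (1 / fact (k + 3)) + cst (1 / fact (k + 3)))"
        by (metis cst_add cst_mult)
      then show ?thesis unfolding mult_2 by (simp only: distrib_right mult.assoc add_diff_cancel_right')
    qed
    then show ?thesis
      by (simp add: 4 two L_u_def L_v_def L_int_def Lmat_def bracket_kernel_def
          mult.assoc numeral_eq_Suc del: fact_Suc)
  qed (simp_all add: two half L_u_def L_v_def L_int_def Lmat_def fps_X_power_mult_nth)
qed

lemma bracket_kernel_laurent:
  fixes i j :: "'n::finite"
  shows "fps_to_fls (bracket_kernel i j) =
    fls_X_inv ^ 2 * (fps_to_fls (L_u $ i $ j) + fps_to_fls (L_v $ i $ j)) -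
    2 * (fls_X_inv ^ 3 * fps_to_fls (L_int $ i $ j))"
proof -
  have inv: "fls_X_inv * (fls_X :: 'n alg fls) = 1"
    by (simp add: fls_X_inv_times_conv_shift fls_X_conv_shift_1)
  have inv3: "fls_X_inv ^ 3 * (fls_X :: 'n alg fls) ^ 3 = 1"
    by (simp add: inv flip: power_mult_distrib)
  have "fls_X * (fps_to_fls (L_u $ i $ j) + fps_to_fls (L_v $ i $ j)) - 2 * fps_to_fls (L_int $ i $ j) =
      fls_X ^ 3 * fps_to_fls (bracket_kernel i j)"
    using arg_cong[OF taylor_integral_identity[of i j], of fps_to_fls]
    unfolding mult_2 by (simp add: fls_times_fps_to_fls fps_to_fls_power)
  then have "fls_X_inv ^ 3 * fls_X ^ 3 * fps_to_fls (bracket_kernel i j) =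
      fls_X_inv ^ 3 * (fls_X * (fps_to_fls (L_u $ i $ j) + fps_to_fls (L_v $ i $ j)) -
        2 * fps_to_fls (L_int $ i $ j))"
    by (simp add: mult.assoc)
  also have "\<dots> = (fls_X_inv * fls_X) * (fls_X_inv ^ 2 *
        (fps_to_fls (L_u $ i $ j) + fps_to_fls (L_v $ i $ j))) -
      2 * (fls_X_inv ^ 3 * fps_to_fls (L_int $ i $ j))"
    by (simp only: power3_eq_cube power2_eq_square right_diff_distrib mult_ac)
  finally show ?thesis by (simp add: inv inv3)
qed

theorem proposition3:
  shows "laurent_mat (mat_bracket bracket2_fps (tens1 L_u) (tens2 L_v)) =
    (commutator
       (tens1 (laurent_mat L_u) + tens1 (laurent_mat L_v))
       (scale_mat (fls_X_inv ^ 2) flip_mat)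
     - scale_mat 2
         (commutator (tens1 (laurent_mat L_int)) (scale_mat (fls_X_inv ^ 3) flip_mat))
     :: 'n::finite alg fls ^('n \<times> 'n)^('n \<times> 'n))"
proof -
  have "laurent_mat (mat_bracket bracket2_fps (tens1 L_u) (tens2 L_v)) $ (i, p) $ (j, q) =
      (commutator (tens1 (laurent_mat L_u + laurent_mat L_v)) (scale_mat (fls_X_inv ^ 2) flip_mat)
       - scale_mat 2
          (commutator (tens1 (laurent_mat L_int)) (scale_mat (fls_X_inv ^ 3) flip_mat))
       :: 'n alg fls ^('n \<times> 'n)^('n \<times> 'n)) $ (i, p) $ (j, q)" for i p j q :: 'n
    unfolding commutator_scale_right mat_bracket_L_u_L_v
    by (simp add: laurent_mat_def scale_mat_def commutator_flip bracket_kernel_laurent)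
       (simp add: algebra_simps)
  then show ?thesis
    by (simp add: tens1_add vec_eq_iff split_paired_all)
qed

end
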